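(* Let $\psi:\mathbb{R}^d\to[0,\infty)$ be a bounded measurable function supported in the unit ball of $\mathbb{R}^d$, let $a:\mathbb{R}^d\to\mathbb{R}^d$ be a diffeomorphism, and let $K(x,y)=\psi(y-a(x))+\psi(x-a(y))$ for $x,y\in\mathbb{R}^d$. Let $\Omega\subset\mathbb{R}^d$ be a bounded domain with $0\in\Omega$, and for $R>0$ consider its dilation $R\Omega=\{Rx : x\in\Omega\}$. Then $$\lambda_1(\mathbb{R}^d)=\lim_{R\to\infty}\lambda_1(R\Omega),$$ where $\lambda_1(\cdot)$ denotes the first eigenvalue associated with the kernel $K$.
   Context: For a bounded domain $\Omega\subset\mathbb{R}^d$, the first eigenvalue associated with the kernel $K$ is given by $$\lambda_1(\Omega)=\inf_{u\in L^2(\Omega),\,u\neq 0}\frac{\int_{\mathbb{R}^d}\int_{\mathbb{R}^d}K(x,y)(\tilde u(x)-\tilde u(y))^2\,dx\,dy}{\int_\Omega u^2(x)\,dx},$$ where $\tilde u$ is the extension of $u$ by zero to $\mathbb{R}^d$. For the whole space, $$\lambda_1(\mathbb{R}^d)=\inf_{u\in L^2(\mathbb{R}^d),\,u\neq 0}\frac{\int_{\mathbb{R}^d}\int_{\mathbb{R}^d}K(x,y)(u(x)-u(y))^2\,dx\,dy}{\int_{\mathbb{R}^d}u^2(x)\,dx}.$$ Functions are real valued. *)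

theory Defs
  imports "HOL-Analysis.Analysis"
begin

definition C1_map :: "('a::real_normed_vector \<Rightarrow> 'b::real_normed_vector) \<Rightarrow> bool" where
  "C1_map f \<longleftrightarrow>
     (\<exists>f' :: 'a \<Rightarrow> 'a \<Rightarrow>\<^sub>L 'b.
        (\<forall>x. (f has_derivative blinfun_apply (f' x)) (at x)) \<and> continuous_on UNIV f')"

(* Of class C^1, the weakest regularity the term is used for; smooth diffeomorphisms are included. *)
definition diffeomorphism :: "(real ^ 'd \<Rightarrow> real ^ 'd) \<Rightarrow> bool" where
  "diffeomorphism f \<longleftrightarrow> bij f \<and> C1_map f \<and> C1_map (inv f)"

(* Functions rather than classes modulo a.e. equality; only the values on \<Omega> matter. *)
definition L2_on :: "(real ^ 'd) set \<Rightarrow> (real ^ 'd \<Rightarrow> real) set" where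
  "L2_on \<Omega> = {u. u \<in> borel_measurable (lebesgue_on \<Omega>) \<and>
                  integrable (lebesgue_on \<Omega>) (\<lambda>x. (u x)\<^sup>2)}"

definition zero_extension :: "(real ^ 'd) set \<Rightarrow> (real ^ 'd \<Rightarrow> real) \<Rightarrow> real ^ 'd \<Rightarrow> real" where
  "zero_extension \<Omega> u = (\<lambda>x. if x \<in> \<Omega> then u x else 0)"

(* The double integral may diverge, hence the value in [0, \<infinity>].
   Intended for kernels K \<ge> 0: the coercion to ennreal would cut off negative values. *)
definition energy :: "(real ^ 'd \<Rightarrow> real ^ 'd \<Rightarrow> real) \<Rightarrow> (real ^ 'd \<Rightarrow> real) \<Rightarrow> ennreal" where
  "energy K v =
     (\<integral>\<^sup>+ y. (\<integral>\<^sup>+ x. ennreal (K x y * (v x - v y)\<^sup>2) \<partial>lebesgue) \<partial>lebesgue)"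

(* u \<noteq> 0 in L^2 means not a.e. zero, so the denominator is positive and finite.
   Functions of infinite energy contribute the value \<infinity> to the infimum. *)
definition first_eigenvalue :: "(real ^ 'd \<Rightarrow> real ^ 'd \<Rightarrow> real) \<Rightarrow> (real ^ 'd) set \<Rightarrow> ennreal" where
  "first_eigenvalue K \<Omega> =
     (INF u \<in> {u \<in> L2_on \<Omega>. \<not> (AE x in lebesgue_on \<Omega>. u x = 0)}.
        energy K (zero_extension \<Omega> u) / ennreal (\<integral>x. (u x)\<^sup>2 \<partial>lebesgue_on \<Omega>))"

lemma first_eigenvalue_UNIV:
  "first_eigenvalue K UNIV =
     (INF u \<in> {u. u \<in> borel_measurable lebesgue \<and> integrable lebesgue (\<lambda>x. (u x)\<^sup>2) \<and>
                  \<not> (AE x in lebesgue. u x = 0)}.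
        energy K u / ennreal (\<integral>x. (u x)\<^sup>2 \<partial>lebesgue))"
  unfolding first_eigenvalue_def L2_on_def lebesgue_on_UNIV_eq
  by (simp add: zero_extension_def conj_assoc)

definition nonlocal_kernel ::
  "(real ^ 'd \<Rightarrow> real) \<Rightarrow> (real ^ 'd \<Rightarrow> real ^ 'd) \<Rightarrow> real ^ 'd \<Rightarrow> real ^ 'd \<Rightarrow> real" where
  "nonlocal_kernel \<psi> a x y = \<psi> (y - a x) + \<psi> (x - a y)"

end

theory Submission
  imports Defs
begin

text \<open>
  Extension by zero makes the eigenvalue antitone in the domain, so only the upper bound
  on \<open>\<lambda>\<^sub>1(R\<Omega>)\<close> is at stake. If \<open>u \<in> L\<^sup>2\<close> has finite energy, its truncations
  \<open>v\<^sub>n\<close> to the balls of radius \<open>n\<close> satisfy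
  \<open>(v\<^sub>n(x) - v\<^sub>n(y))\<^sup>2 \<le> 2 (u(x) - u(y))\<^sup>2 + 2 u(x)\<^sup>2\<close>, and the same with \<open>u(y)\<^sup>2\<close> as
  last term. Using the first bound against \<open>\<psi>(y - a(x))\<close> and the second against
  \<open>\<psi>(x - a(y))\<close> gives a dominating function of integral
  \<open>2 E(u) + 4 \<parallel>\<psi>\<parallel>\<^sub>1 \<parallel>u\<parallel>\<^sup>2\<close>.
  Dominated convergence shows that the Rayleigh quotients of the \<open>v\<^sub>n\<close> converge to that of
  \<open>u\<close>, and \<open>R\<Omega>\<close> contains any given ball for large \<open>R\<close>.
\<close>

section \<open>Zero extension and monotonicity in the domain\<close>

lemma zero_extension_eq_indicator: "zero_extension A u = (\<lambda>x. indicator A x *\<^sub>R u x)"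
  by (auto simp: zero_extension_def fun_eq_iff)

lemma zero_extension_power2: "(zero_extension A u x)\<^sup>2 = indicator A x *\<^sub>R (u x)\<^sup>2"
  by (auto simp: zero_extension_def)

lemma L2_on_iff_zero_extension:
  assumes "A \<in> sets lebesgue"
  shows "u \<in> L2_on A \<longleftrightarrow> zero_extension A u \<in> L2_on UNIV"
proof -
  have "A \<inter> space lebesgue \<in> sets lebesgue" using assms by simp
  then show ?thesis
    unfolding L2_on_def lebesgue_on_UNIV_eq mem_Collect_eq zero_extension_power2
    by (simp only: borel_measurable_restrict_space_iff integrable_restrict_space zero_extension_eq_indicator)
qed

text \<open>Zero extension maps the competitors on \<open>A\<close> onto the whole-space functions
  that vanish off \<open>A\<close>, preserving norms and a.e. vanishing. All domains then share one
  quotient and differ only in the index set, so monotonicity becomes an inclusion of index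
  sets.\<close>

lemma first_eigenvalue_eq_INF_supported:
  assumes "A \<in> sets lebesgue"
  shows "first_eigenvalue K A =
    (INF v \<in> {v \<in> L2_on UNIV. (\<forall>x. x \<notin> A \<longrightarrow> v x = 0) \<and> \<not> (AE x in lebesgue. v x = 0)}.
       energy K v / ennreal (\<integral>x. (v x)\<^sup>2 \<partial>lebesgue))"
proof -
  have A: "A \<inter> space lebesgue \<in> sets lebesgue" using assms by simp
  have int: "(\<integral>x. (u x)\<^sup>2 \<partial>lebesgue_on A) = (\<integral>x. (zero_extension A u x)\<^sup>2 \<partial>lebesgue)" for u
    unfolding zero_extension_power2 by (rule integral_restrict_space[OF A])
  have ae: "(AE x in lebesgue_on A. u x = 0) \<longleftrightarrow> (AE x in lebesgue. zero_extension A u x = 0)" for u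
    unfolding AE_restrict_space_iff[OF A] by (intro AE_cong) (auto simp: zero_extension_def)
  have supp: "zero_extension A u x = 0" if "x \<notin> A" for u x
    using that by (simp add: zero_extension_def)
  have fixed: "zero_extension A v = v" if "\<forall>x. x \<notin> A \<longrightarrow> v x = 0" for v
    using that by (auto simp: zero_extension_def fun_eq_iff)
  have img: "{v \<in> L2_on UNIV. (\<forall>x. x \<notin> A \<longrightarrow> v x = 0) \<and> \<not> (AE x in lebesgue. v x = 0)}
      = zero_extension A ` {u \<in> L2_on A. \<not> (AE x in lebesgue_on A. u x = 0)}" (is "?L = ?R")
  proof
    show "?R \<subseteq> ?L"
      unfolding ae L2_on_iff_zero_extension[OF assms] using supp by auto
    show "?L \<subseteq> ?R"
    proof
      fix v assume v: "v \<in> ?L"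
      then have "zero_extension A v = v" using fixed by blast
      with v show "v \<in> ?R"
        unfolding ae L2_on_iff_zero_extension[OF assms] by (intro image_eqI[of _ _ v]) auto
    qed
  qed
  show ?thesis
    unfolding first_eigenvalue_def img image_image int ..
qed

lemma first_eigenvalue_antimono:
  assumes "A \<in> sets lebesgue" "B \<in> sets lebesgue" "A \<subseteq> B"
  shows "first_eigenvalue K B \<le> first_eigenvalue K A"
  unfolding first_eigenvalue_eq_INF_supported[OF assms(1)] first_eigenvalue_eq_INF_supported[OF assms(2)]
  using assms(3) by (intro INF_superset_mono) auto

section \<open>Independence of the choice of a.e. representatives\<close>

lemma AE_lborel_translate:
  fixes c :: "'a::euclidean_space"
  assumes "AE x in lborel. P x"
  shows "AE x in lborel. P (x - c)"
proof -
  \<comment> \<open>\<open>P\<close> need not be measurable, so a Borel null set covering its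
    exceptional points is transported instead.\<close>
  obtain N where N: "N \<in> null_sets lborel" "{x. \<not> P x} \<subseteq> N"
    using assms by (auto simp: eventually_ae_filter)
  have [measurable]: "N \<in> sets borel" using N(1) by auto
  have "AE x in distr lborel borel ((+) (- c)). x \<notin> N"
    unfolding lborel_distr_plus by (rule AE_not_in[OF N(1)])
  then have "AE x in lborel. - c + x \<notin> N"
    by (subst (asm) AE_distr_iff) auto
  then show ?thesis
    by (rule AE_mp) (use N(2) in \<open>auto intro!: AE_I2 simp: add.commute\<close>)
qed

text \<open>For fixed \<open>y\<close> the exceptional set of \<open>x\<close> is a preimage under
  \<open>a\<close>, which a Borel map need not keep null. For fixed \<open>x\<close> the exceptional
  set of \<open>y\<close> is a translate of a null set, and Tonelli exchanges the two
  quantifiers.\<close>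

lemma AE_AE_lborel_shear:
  fixes a :: "'a::euclidean_space \<Rightarrow> 'b::euclidean_space"
  assumes [measurable]: "a \<in> borel_measurable borel" and "AE x in lborel. P x"
  shows "AE y in lborel. AE x in lborel. P (y - a x)"
proof -
  obtain N where N: "N \<in> null_sets lborel" "{x. \<not> P x} \<subseteq> N"
    using assms(2) by (auto simp: eventually_ae_filter)
  have [measurable]: "N \<in> sets borel" using N(1) by auto
  have "AE x in lborel. AE y in lborel. y - a x \<notin> N"
    by (intro AE_I2 AE_lborel_translate[of "\<lambda>y. y \<notin> N"] AE_not_in N(1))
  then have "AE y in lborel. AE x in lborel. y - a x \<notin> N"
    by (subst (asm) lborel_pair.AE_commute) measurable
  then show ?thesis
    by (elim eventually_mono) (use N(2) in auto)
qed

text \<open>This permits Borel representatives: for a Lebesgue measurable \<psi>, composition with a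
  Borel map \<open>a\<close> may lose measurability. The summand \<open>\<psi> (x - a y)\<close> is
  handled by translation, the summand \<open>\<psi> (y - a x)\<close> by the shear lemma.\<close>

lemma energy_nonlocal_kernel_cong_AE:
  fixes a :: "real ^ 'd \<Rightarrow> real ^ 'd"
  assumes a: "a \<in> borel_measurable borel"
    and \<psi>: "AE x in lborel. \<psi> x = \<psi>' x" and u: "AE x in lborel. u x = u' x"
  shows "energy (nonlocal_kernel \<psi> a) u = energy (nonlocal_kernel \<psi>' a) u'"
  \<comment> \<open>Passing from \<open>lebesgue\<close> to \<open>lborel\<close> requires no
    measurability here, since \<open>nn_integral\<close> is a supremum over simple functions below
    the integrand.\<close>
  unfolding energy_def nn_integral_completion
proof (rule nn_integral_cong_AE)
  show "AE y in lborel.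
      (\<integral>\<^sup>+x. ennreal (nonlocal_kernel \<psi> a x y * (u x - u y)\<^sup>2) \<partial>lborel) =
      (\<integral>\<^sup>+x. ennreal (nonlocal_kernel \<psi>' a x y * (u' x - u' y)\<^sup>2) \<partial>lborel)"
    using u AE_AE_lborel_shear[OF a \<psi>]
  proof eventually_elim
    case (elim y)
    from elim(2) u AE_lborel_translate[OF \<psi>, of "a y"]
    have "AE x in lborel. ennreal (nonlocal_kernel \<psi> a x y * (u x - u y)\<^sup>2)
      = ennreal (nonlocal_kernel \<psi>' a x y * (u' x - u' y)\<^sup>2)"
      by eventually_elim (simp add: nonlocal_kernel_def elim(1))
    then show ?case by (rule nn_integral_cong_AE)
  qed
qed

lemma nn_integral_lborel_translate:
  fixes f :: "'a::euclidean_space \<Rightarrow> ennreal"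
  assumes [measurable]: "f \<in> borel_measurable borel"
  shows "(\<integral>\<^sup>+x. f (x - c) \<partial>lborel) = (\<integral>\<^sup>+x. f x \<partial>lborel)"
proof -
  have "(\<integral>\<^sup>+x. f x \<partial>lborel) = (\<integral>\<^sup>+x. f x \<partial>distr lborel borel ((+) (- c)))"
    unfolding lborel_distr_plus ..
  also have "\<dots> = (\<integral>\<^sup>+x. f (- c + x) \<partial>lborel)"
    by (rule nn_integral_distr) auto
  finally show ?thesis by (simp add: add.commute)
qed

section \<open>Truncation to balls\<close>

lemma eventually_zero_extension_ball: "eventually (\<lambda>n. zero_extension (ball 0 (real n)) u x = u x) sequentially"
proof -
  obtain N :: nat where "norm x < real N" using reals_Archimedean2 by blast
  then show ?thesis
    by (intro eventually_sequentiallyI[of N]) (auto simp: zero_extension_def)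
qed

text \<open>Borel data make the integrand jointly measurable, so the iterated integral becomes one
  integral over the product and a single dominated convergence suffices.\<close>

lemma tendsto_energy_truncation_borel:
  fixes a :: "real ^ 'd \<Rightarrow> real ^ 'd"
  assumes [measurable]: "a \<in> borel_measurable borel" "\<psi> \<in> borel_measurable borel" "u \<in> borel_measurable borel"
    and nonneg: "\<And>x. 0 \<le> \<psi> x"
    and \<psi>: "(\<integral>\<^sup>+x. ennreal (\<psi> x) \<partial>lborel) < \<infinity>"
    and u: "(\<integral>\<^sup>+x. ennreal ((u x)\<^sup>2) \<partial>lborel) < \<infinity>"
    and E: "energy (nonlocal_kernel \<psi> a) u < \<infinity>"
  shows "(\<lambda>n. energy (nonlocal_kernel \<psi> a) (zero_extension (ball 0 (real n)) u))
           \<longlonglongrightarrow> energy (nonlocal_kernel \<psi> a) u"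
proof -
  let ?K = "nonlocal_kernel \<psi> a"
  let ?M = "lborel \<Otimes>\<^sub>M lborel :: ((real^'d) \<times> (real^'d)) measure"
  define v where "v n = zero_extension (ball 0 (real n)) u" for n
  have [measurable]: "v n \<in> borel_measurable borel" for n
    unfolding v_def zero_extension_eq_indicator
    by (intro borel_measurable_scaleR borel_measurable_indicator assms(3)) simp
  have energy_eq: "energy ?K w = (\<integral>\<^sup>+z. ennreal (?K (fst z) (snd z) * (w (fst z) - w (snd z))\<^sup>2) \<partial>?M)"
    if [measurable]: "w \<in> borel_measurable borel" for w
    unfolding energy_def nn_integral_completion nonlocal_kernel_def
    by (subst lborel_pair.nn_integral_snd[symmetric]) auto
  let ?C = "(\<integral>\<^sup>+x. ennreal (\<psi> x) \<partial>lborel) * (\<integral>\<^sup>+x. ennreal ((u x)\<^sup>2) \<partial>lborel)"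
  have C: "?C < \<infinity>" using \<psi> u by (simp add: ennreal_mult_less_top)
  \<comment> \<open>The weight \<open>(u y)\<^sup>2\<close> is paired with the summand whose
    argument of \<open>a\<close> is \<open>y\<close>. With \<open>y\<close> frozen, the integral
    over \<open>x\<close> only involves a translation, and no Jacobian of \<open>a\<close>
    enters.\<close>
  have slice: "(\<integral>\<^sup>+x. ennreal (\<psi> (x - a y) * (u y)\<^sup>2) \<partial>lborel)
      = (\<integral>\<^sup>+x. ennreal (\<psi> x) \<partial>lborel) * ennreal ((u y)\<^sup>2)" for y
    using nn_integral_lborel_translate[of "\<lambda>x. ennreal (\<psi> x)" "a y"]
    by (simp add: ennreal_mult nonneg nn_integral_multc)
  have "(\<integral>\<^sup>+y. \<integral>\<^sup>+x. ennreal (\<psi> (x - a y) * (u y)\<^sup>2) \<partial>lborel \<partial>lborel) = ?C"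
    unfolding slice by (rule nn_integral_cmult) auto
  \<comment> \<open>Tonelli is applied in both orders, each time with the variable under
    \<open>a\<close> as the outer one; up to renaming the two iterated integrals coincide.\<close>
  then have D1: "(\<integral>\<^sup>+z. ennreal (\<psi> (fst z - a (snd z)) * (u (snd z))\<^sup>2) \<partial>?M) = ?C"
    and D2: "(\<integral>\<^sup>+z. ennreal (\<psi> (snd z - a (fst z)) * (u (fst z))\<^sup>2) \<partial>?M) = ?C"
    by (subst lborel_pair.nn_integral_snd[symmetric] lborel.nn_integral_fst[symmetric]; simp)+
  define w where "w z = 2 * (ennreal (?K (fst z) (snd z) * (u (fst z) - u (snd z))\<^sup>2)
      + ennreal (\<psi> (fst z - a (snd z)) * (u (snd z))\<^sup>2)
      + ennreal (\<psi> (snd z - a (fst z)) * (u (fst z))\<^sup>2))" for z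
  have "(\<lambda>n. \<integral>\<^sup>+z. ennreal (?K (fst z) (snd z) * (v n (fst z) - v n (snd z))\<^sup>2) \<partial>?M)
      \<longlonglongrightarrow> (\<integral>\<^sup>+z. ennreal (?K (fst z) (snd z) * (u (fst z) - u (snd z))\<^sup>2) \<partial>?M)"
  proof (rule nn_integral_dominated_convergence[where w=w])
    show "(\<lambda>z. ennreal (?K (fst z) (snd z) * (v n (fst z) - v n (snd z))\<^sup>2)) \<in> borel_measurable ?M" for n
      unfolding nonlocal_kernel_def by measurable
    show "(\<lambda>z. ennreal (?K (fst z) (snd z) * (u (fst z) - u (snd z))\<^sup>2)) \<in> borel_measurable ?M"
      unfolding nonlocal_kernel_def by measurable
    show "w \<in> borel_measurable ?M"
      unfolding w_def nonlocal_kernel_def by measurable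
    have "(\<integral>\<^sup>+z. w z \<partial>?M) = 2 * (energy ?K u + ?C + ?C)"
      unfolding w_def energy_eq[OF assms(3)] nonlocal_kernel_def
      by (subst nn_integral_cmult, measurable, subst nn_integral_add, measurable,
          subst nn_integral_add, measurable, simp add: D1 D2)
    then show "(\<integral>\<^sup>+z. w z \<partial>?M) < \<infinity>" using E C by (simp add: ennreal_mult_less_top)
    show "AE z in ?M. (\<lambda>n. ennreal (?K (fst z) (snd z) * (v n (fst z) - v n (snd z))\<^sup>2))
        \<longlonglongrightarrow> ennreal (?K (fst z) (snd z) * (u (fst z) - u (snd z))\<^sup>2)"
    proof (intro AE_I2 tendsto_eventually)
      fix z :: "(real^'d) \<times> (real^'d)"
      from eventually_zero_extension_ball[of u "fst z"] eventually_zero_extension_ball[of u "snd z"]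
      show "eventually (\<lambda>n. ennreal (?K (fst z) (snd z) * (v n (fst z) - v n (snd z))\<^sup>2) =
          ennreal (?K (fst z) (snd z) * (u (fst z) - u (snd z))\<^sup>2)) sequentially"
        by eventually_elim (simp add: v_def)
    qed
    show "AE z in ?M. ennreal (?K (fst z) (snd z) * (v n (fst z) - v n (snd z))\<^sup>2) \<le> w z" for n
    proof (rule AE_I2)
      fix z :: "(real^'d) \<times> (real^'d)"
      obtain x y where z: "z = (x, y)" by (cases z)
      \<comment> \<open>The difference of the two sides is
        \<open>(p - 2 * q)\<^sup>2\<close>.\<close>
      have sq: "p\<^sup>2 \<le> 2 * (p - q)\<^sup>2 + 2 * q\<^sup>2" for p q :: real
        using zero_le_power2[of "p - 2 * q"] by (simp add: power2_eq_square algebra_simps)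
      \<comment> \<open>Four cases: both points in the ball, neither, or exactly one. Only the case
        of \<open>y\<close> alone inside needs \<open>sq\<close>, to trade
        \<open>(u y)\<^sup>2\<close> for \<open>(u x)\<^sup>2\<close>; \<open>dy\<close> is the
        mirror image.\<close>
      have dx: "(v n x - v n y)\<^sup>2 \<le> 2 * (u x - u y)\<^sup>2 + 2 * (u x)\<^sup>2"
        using sq[of "u y" "u x"] zero_le_power2[of "u x - u y"] zero_le_power2[of "u x"]
        by (auto simp: v_def zero_extension_def power2_commute)
      have dy: "(v n x - v n y)\<^sup>2 \<le> 2 * (u x - u y)\<^sup>2 + 2 * (u y)\<^sup>2"
        using sq[of "u x" "u y"] zero_le_power2[of "u x - u y"] zero_le_power2[of "u y"]
        by (auto simp: v_def zero_extension_def power2_commute)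
      have "?K x y * (v n x - v n y)\<^sup>2 \<le> 2 * (?K x y * (u x - u y)\<^sup>2
          + \<psi> (x - a y) * (u y)\<^sup>2 + \<psi> (y - a x) * (u x)\<^sup>2)"
        using mult_left_mono[OF dx nonneg[of "y - a x"]] mult_left_mono[OF dy nonneg[of "x - a y"]]
        by (simp add: nonlocal_kernel_def algebra_simps)
      also have "ennreal \<dots> = w z"
        using nonneg by (simp add: w_def z nonlocal_kernel_def ennreal_mult ennreal_plus)
      finally show "ennreal (?K (fst z) (snd z) * (v n (fst z) - v n (snd z))\<^sup>2) \<le> w z"
        by (simp add: z ennreal_leI)
    qed
  qed
  then show ?thesis
    by (simp add: energy_eq v_def[symmetric])
qed

text \<open>Reduction to Borel representatives of \<psi> and \<open>u\<close>: truncating preserves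
  a.e. equality, so neither the limit nor any term of the sequence changes.\<close>

lemma tendsto_energy_truncation:
  fixes a :: "real ^ 'd \<Rightarrow> real ^ 'd"
  assumes a: "a \<in> borel_measurable borel" and \<psi>_meas: "\<psi> \<in> borel_measurable lebesgue"
    and nonneg: "\<And>x. 0 \<le> \<psi> x"
    and \<psi>: "(\<integral>\<^sup>+x. ennreal (\<psi> x) \<partial>lebesgue) < \<infinity>"
    and u: "u \<in> L2_on UNIV" and E: "energy (nonlocal_kernel \<psi> a) u < \<infinity>"
  shows "(\<lambda>n. energy (nonlocal_kernel \<psi> a) (zero_extension (ball 0 (real n)) u))
           \<longlonglongrightarrow> energy (nonlocal_kernel \<psi> a) u"
proof -
  obtain \<psi>0 where \<psi>0: "\<psi>0 \<in> borel_measurable lborel" "AE x in lborel. \<psi> x = \<psi>0 x"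
    using completion_ex_borel_measurable_real[OF \<psi>_meas] by auto
  \<comment> \<open>A Borel representative may be negative on a null set; the maximum with 0
    restores nonnegativity everywhere.\<close>
  define \<psi>' where "\<psi>' x = max 0 (\<psi>0 x)" for x
  have \<psi>'_meas: "\<psi>' \<in> borel_measurable borel"
    using \<psi>0(1) unfolding \<psi>'_def by simp
  have \<psi>': "AE x in lborel. \<psi> x = \<psi>' x"
    using \<psi>0(2) by eventually_elim (metis \<psi>'_def max.absorb2 nonneg)
  have "u \<in> borel_measurable lebesgue" "integrable lebesgue (\<lambda>x. (u x)\<^sup>2)"
    using u by (auto simp: L2_on_def lebesgue_on_UNIV_eq)
  obtain u' where u': "u' \<in> borel_measurable lborel" "AE x in lborel. u x = u' x"
    using completion_ex_borel_measurable_real[OF \<open>u \<in> borel_measurable lebesgue\<close>] by auto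
  have energy_trunc: "energy (nonlocal_kernel \<psi> a) (zero_extension B u)
      = energy (nonlocal_kernel \<psi>' a) (zero_extension B u')" for B
    by (rule energy_nonlocal_kernel_cong_AE[OF a \<psi>'], rule eventually_mono[OF u'(2)])
      (simp add: zero_extension_def)
  have energy: "energy (nonlocal_kernel \<psi> a) u = energy (nonlocal_kernel \<psi>' a) u'"
    by (rule energy_nonlocal_kernel_cong_AE[OF a \<psi>' u'(2)])
  show ?thesis
    unfolding energy_trunc energy
  proof (rule tendsto_energy_truncation_borel)
    have "(\<integral>\<^sup>+x. ennreal (\<psi>' x) \<partial>lborel) = (\<integral>\<^sup>+x. ennreal (\<psi> x) \<partial>lborel)"
      by (rule nn_integral_cong_AE, rule eventually_mono[OF \<psi>']) simp
    with \<psi> show "(\<integral>\<^sup>+x. ennreal (\<psi>' x) \<partial>lborel) < \<infinity>"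
      by (simp add: nn_integral_completion)
    have "(\<integral>\<^sup>+x. ennreal ((u' x)\<^sup>2) \<partial>lborel) = (\<integral>\<^sup>+x. ennreal ((u x)\<^sup>2) \<partial>lebesgue)"
      unfolding nn_integral_completion
      by (rule nn_integral_cong_AE, rule eventually_mono[OF u'(2)]) simp
    also have "\<dots> < \<infinity>"
      using \<open>integrable lebesgue (\<lambda>x. (u x)\<^sup>2)\<close>
      by (simp add: integrable_iff_bounded)
    finally show "(\<integral>\<^sup>+x. ennreal ((u' x)\<^sup>2) \<partial>lborel) < \<infinity>" .
  qed (use a \<psi>'_meas u'(1) E in \<open>auto simp: energy \<psi>'_def\<close>)
qed

lemma L2_on_zero_extension:
  assumes "u \<in> L2_on UNIV" "B \<in> sets lebesgue"
  shows "zero_extension B u \<in> L2_on UNIV"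
  using assms integrable_mult_indicator[of B lebesgue "\<lambda>x. (u x)\<^sup>2"]
  unfolding L2_on_def lebesgue_on_UNIV_eq mem_Collect_eq zero_extension_power2
  by (auto simp: zero_extension_eq_indicator)

lemma tendsto_L2_truncation:
  fixes u :: "real ^ 'd \<Rightarrow> real"
  assumes "u \<in> L2_on UNIV"
  shows "(\<lambda>n. \<integral>x. (zero_extension (ball 0 (real n)) u x)\<^sup>2 \<partial>lebesgue) \<longlonglongrightarrow> (\<integral>x. (u x)\<^sup>2 \<partial>lebesgue)"
proof (rule integral_dominated_convergence[where w="\<lambda>x. (u x)\<^sup>2"])
  show "integrable lebesgue (\<lambda>x. (u x)\<^sup>2)"
    using assms by (simp add: L2_on_def lebesgue_on_UNIV_eq)
  then show "(\<lambda>x. (u x)\<^sup>2) \<in> borel_measurable lebesgue"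
    by (rule borel_measurable_integrable)
  show "(\<lambda>x. (zero_extension (ball 0 (real n)) u x)\<^sup>2) \<in> borel_measurable lebesgue" for n
    using L2_on_zero_extension[OF assms, of "ball 0 (real n)"]
    by (intro borel_measurable_integrable) (simp add: L2_on_def lebesgue_on_UNIV_eq)
  show "AE x in lebesgue. (\<lambda>n. (zero_extension (ball 0 (real n)) u x)\<^sup>2) \<longlonglongrightarrow> (u x)\<^sup>2"
  proof (intro AE_I2 tendsto_eventually)
    show "eventually (\<lambda>n. (zero_extension (ball 0 (real n)) u x)\<^sup>2 = (u x)\<^sup>2) sequentially" for x
      using eventually_zero_extension_ball[of u x] by eventually_elim simp
  qed
  show "AE x in lebesgue. norm ((zero_extension (ball 0 (real n)) u x)\<^sup>2) \<le> (u x)\<^sup>2" for n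
    by (auto simp: zero_extension_def)
qed

section \<open>Convergence of Rayleigh quotients\<close>

lemma tendsto_divide_ennreal_real:
  fixes f :: "'a \<Rightarrow> ennreal" and g :: "'a \<Rightarrow> real"
  assumes f: "(f \<longlongrightarrow> l) F" and g: "(g \<longlongrightarrow> m) F" and "0 < m"
  shows "((\<lambda>x. f x / ennreal (g x)) \<longlongrightarrow> l / ennreal m) F"
proof -
  \<comment> \<open>The second factor tends to a positive finite limit, so the product avoids the
    form 0 times infinity even when \<open>l\<close> is infinite.\<close>
  have "((\<lambda>x. f x * ennreal (inverse (g x))) \<longlongrightarrow> l * ennreal (inverse m)) F"
    using f g \<open>0 < m\<close> by (intro tendsto_mult_ennreal tendsto_ennrealI tendsto_inverse) auto
  \<comment> \<open>Agreement holds only where \<open>g x\<close> is positive: at 0 the real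
    \<open>inverse\<close> is 0, while inversion in \<open>ennreal\<close> gives infinity.\<close>
  moreover have "eventually (\<lambda>x. f x * ennreal (inverse (g x)) = f x / ennreal (g x)) F"
    using order_tendstoD(1)[OF g \<open>0 < m\<close>]
    by eventually_elim (simp add: divide_ennreal_def inverse_ennreal)
  ultimately show ?thesis
    using \<open>0 < m\<close> by (simp add: divide_ennreal_def inverse_ennreal tendsto_cong)
qed

text \<open>A competitor on the whole space with quotient below \<open>c\<close> has truncations
  whose quotients converge to its own, so some truncation is a competitor on a ball and still lies
  below \<open>c\<close>.\<close>

lemma first_eigenvalue_ball_less:
  fixes a :: "real ^ 'd \<Rightarrow> real ^ 'd"
  assumes a: "a \<in> borel_measurable borel" and \<psi>_meas: "\<psi> \<in> borel_measurable lebesgue"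
    and nonneg: "\<And>x. 0 \<le> \<psi> x"
    and \<psi>: "(\<integral>\<^sup>+x. ennreal (\<psi> x) \<partial>lebesgue) < \<infinity>"
    and c: "first_eigenvalue (nonlocal_kernel \<psi> a) UNIV < c"
  shows "\<exists>n. first_eigenvalue (nonlocal_kernel \<psi> a) (ball 0 (real n)) < c"
proof -
  let ?K = "nonlocal_kernel \<psi> a"
  obtain u where u: "u \<in> L2_on UNIV" and u0: "\<not> (AE x in lebesgue. u x = 0)"
    and uc: "energy ?K u / ennreal (\<integral>x. (u x)\<^sup>2 \<partial>lebesgue) < c"
    using c by (auto simp: first_eigenvalue_eq_INF_supported INF_less_iff)
  have int: "integrable lebesgue (\<lambda>x. (u x)\<^sup>2)"
    using u by (simp add: L2_on_def lebesgue_on_UNIV_eq)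
  have "(\<integral>x. (u x)\<^sup>2 \<partial>lebesgue) \<noteq> 0"
    using integral_nonneg_eq_0_iff_AE[OF int] u0 by simp
  then have pos: "0 < (\<integral>x. (u x)\<^sup>2 \<partial>lebesgue)"
    by (simp add: order_less_le eq_commute[of 0])
  \<comment> \<open>The denominator is finite, so infinite energy would make the quotient infinite
    and contradict \<open>uc\<close>. Finiteness is what dominated convergence requires.\<close>
  have E: "energy ?K u < \<infinity>"
  proof (rule ccontr)
    assume "\<not> energy ?K u < \<infinity>"
    then have "energy ?K u = \<infinity>" by (simp add: less_top[symmetric])
    then have "energy ?K u / ennreal (\<integral>x. (u x)\<^sup>2 \<partial>lebesgue) = \<infinity>"
      by (simp add: ennreal_top_divide)
    with uc show False by simp
  qed
  define v where "v n = zero_extension (ball 0 (real n)) u" for n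
  have norm_lim: "(\<lambda>n. \<integral>x. (v n x)\<^sup>2 \<partial>lebesgue) \<longlonglongrightarrow> (\<integral>x. (u x)\<^sup>2 \<partial>lebesgue)"
    unfolding v_def by (rule tendsto_L2_truncation[OF u])
  have "(\<lambda>n. energy ?K (v n) / ennreal (\<integral>x. (v n x)\<^sup>2 \<partial>lebesgue))
      \<longlonglongrightarrow> energy ?K u / ennreal (\<integral>x. (u x)\<^sup>2 \<partial>lebesgue)"
    using tendsto_energy_truncation[OF a \<psi>_meas nonneg \<psi> u E] norm_lim pos
    unfolding v_def by (rule tendsto_divide_ennreal_real)
  then have "\<forall>\<^sub>F n in sequentially. energy ?K (v n) / ennreal (\<integral>x. (v n x)\<^sup>2 \<partial>lebesgue) < c"
    using uc by (rule order_tendstoD)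
  \<comment> \<open>A positive norm ensures that the truncation is not a.e. zero, hence
    admissible.\<close>
  moreover have "\<forall>\<^sub>F n in sequentially. 0 < (\<integral>x. (v n x)\<^sup>2 \<partial>lebesgue)"
    using norm_lim pos by (rule order_tendstoD)
  ultimately have "\<forall>\<^sub>F n in sequentially. energy ?K (v n) / ennreal (\<integral>x. (v n x)\<^sup>2 \<partial>lebesgue) < c
      \<and> 0 < (\<integral>x. (v n x)\<^sup>2 \<partial>lebesgue)"
    by eventually_elim simp
  then obtain n where n: "energy ?K (v n) / ennreal (\<integral>x. (v n x)\<^sup>2 \<partial>lebesgue) < c"
    "0 < (\<integral>x. (v n x)\<^sup>2 \<partial>lebesgue)"
    using eventually_happens'[OF sequentially_bot] by blast
  have "\<not> (AE x in lebesgue. v n x = 0)"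
  proof
    assume "AE x in lebesgue. v n x = 0"
    then have "(\<integral>x. (v n x)\<^sup>2 \<partial>lebesgue) = 0"
      by (rule integral_eq_zero_AE[OF eventually_mono]) simp
    with n(2) show False by simp
  qed
  moreover have "v n \<in> L2_on UNIV" "\<forall>x. x \<notin> ball 0 (real n) \<longrightarrow> v n x = 0"
    using L2_on_zero_extension[OF u, of "ball 0 (real n)"] by (auto simp: v_def zero_extension_def)
  ultimately have "first_eigenvalue ?K (ball 0 (real n)) < c"
    using n(1) by (subst first_eigenvalue_eq_INF_supported) (auto simp: INF_less_iff)
  then show ?thesis ..
qed

section \<open>From balls to dilations of the domain\<close>

theorem theorem1p1:
  fixes \<psi> :: "real ^ 'd \<Rightarrow> real"
    and a :: "real ^ 'd \<Rightarrow> real ^ 'd"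
    and \<Omega> :: "(real ^ 'd) set"
  assumes "\<psi> \<in> borel_measurable lebesgue"
    and "\<And>x. 0 \<le> \<psi> x"
    and "bounded (range \<psi>)"
    and "{x. \<psi> x \<noteq> 0} \<subseteq> cball 0 1"
    and "diffeomorphism a"
    and "open \<Omega>" and "connected \<Omega>" and "bounded \<Omega>" and "0 \<in> \<Omega>"
  shows "((\<lambda>R::real. first_eigenvalue (nonlocal_kernel \<psi> a) ((\<lambda>x. R *\<^sub>R x) ` \<Omega>))
            \<longlongrightarrow> first_eigenvalue (nonlocal_kernel \<psi> a) UNIV) at_top"
proof (rule order_tendstoI)
  let ?ev = "first_eigenvalue (nonlocal_kernel \<psi> a)"
  let ?D = "\<lambda>R::real. (\<lambda>x. R *\<^sub>R x) ` \<Omega>"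
  have D: "?D R \<in> sets lebesgue" if "0 < R" for R
    using open_scaling[of R \<Omega>] that assms(6) by auto
  \<comment> \<open>By monotonicity the whole space has the smallest eigenvalue, so this half holds
    for every positive \<open>R\<close>.\<close>
  show "\<forall>\<^sub>F R in at_top. c < ?ev (?D R)" if "c < ?ev UNIV" for c
    using eventually_gt_at_top[of 0]
  proof eventually_elim
    case (elim R)
    from that first_eigenvalue_antimono[OF D[OF elim]] show ?case
      by (rule less_le_trans) auto
  qed
  show "\<forall>\<^sub>F R in at_top. ?ev (?D R) < c" if c: "?ev UNIV < c" for c
  proof -
    obtain f' where "\<And>x. (a has_derivative blinfun_apply (f' x)) (at x)"
      using assms(5) by (auto simp: diffeomorphism_def C1_map_def)
    then have "continuous_on UNIV a"
      by (meson continuous_at_imp_continuous_on has_derivative_continuous)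
    then have a: "a \<in> borel_measurable borel"
      by (rule borel_measurable_continuous_onI)
    obtain B where B: "\<And>x. norm (\<psi> x) \<le> B"
      using assms(3) by (auto simp: bounded_iff)
    have "(\<integral>\<^sup>+x. ennreal (\<psi> x) \<partial>lebesgue)
        \<le> (\<integral>\<^sup>+x. ennreal B * indicator (cball (0::real^'d) 1) x \<partial>lebesgue)"
    proof (rule nn_integral_mono)
      fix x show "ennreal (\<psi> x) \<le> ennreal B * indicator (cball 0 1) x"
        using B[of x] subsetD[OF assms(4), of x]
        by (cases "\<psi> x = 0") (auto simp: indicator_def intro!: ennreal_leI)
    qed
    also have "\<dots> = ennreal B * emeasure lborel (cball (0::real^'d) 1)"
      by (subst nn_integral_cmult_indicator) auto
    also have "\<dots> < \<infinity>"
      using emeasure_lborel_cball_finite[of "0::real^'d" 1] by (simp add: ennreal_mult_less_top)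
    finally obtain n where n: "?ev (ball 0 (real n)) < c"
      using first_eigenvalue_ball_less[OF a assms(1,2) _ c] by blast
    obtain r where r: "0 < r" "ball 0 r \<subseteq> \<Omega>"
      using assms(6,9) open_contains_ball by blast
    \<comment> \<open>The threshold \<open>real n / r\<close> is chosen so that shrinking the ball
      of radius \<open>n\<close> by \<open>R\<close> lands inside the ball of radius
      \<open>r\<close> around 0, which lies in \<Omega>.\<close>
    show ?thesis
      using eventually_gt_at_top[of 0] eventually_ge_at_top[of "real n / r"]
    proof eventually_elim
      case (elim R)
      have "ball 0 (real n) \<subseteq> ?D R"
      proof
        fix x :: "real^'d" assume "x \<in> ball 0 (real n)"
        then have "norm x < R * r"
          using elim(2) r(1) by (simp add: field_simps)
        then have "norm (inverse R *\<^sub>R x) < r"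
          using elim(1) by (simp add: field_simps)
        then have "inverse R *\<^sub>R x \<in> \<Omega>" using r(2) by auto
        then show "x \<in> ?D R" using elim(1) by (intro image_eqI[of _ _ "inverse R *\<^sub>R x"]) auto
      qed
      then have "?ev (?D R) \<le> ?ev (ball 0 (real n))"
        by (intro first_eigenvalue_antimono D elim(1)) auto
      then show ?case using n by (rule le_less_trans)
    qed
  qed
qed

end
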